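(* Let $M$ be a pointed metric space and let $f\in\operatorname{Lip}_0(M)$ with $\|f\|=1$. If $f$ is local, then $f$ is a Daugavet point of $\operatorname{Lip}_0(M)$.
   Context: For a pointed metric space $M$ (a metric space with metric $d$ and a fixed point $0\in M$), $\operatorname{Lip}_0(M)$ is the real Banach space of all Lipschitz functions $f\colon M\to\mathbb{R}$ with $f(0)=0$, with norm $\|f\|=\sup\{|f(x)-f(y)|/d(x,y)\colon x,y\in M,\ x\neq y\}$. For $x\neq y$ in $M$ write $f(m_{x,y})=\frac{f(x)-f(y)}{d(x,y)}$. A function $f\in\operatorname{Lip}_0(M)$ is local if, for every $\varepsilon>0$, there are $u,v\in M$ with $u\neq v$ such that $d(u,v)<\varepsilon$ and $f(m_{u,v})>\|f\|-\varepsilon$. For a Banach space $X$ with closed unit ball $B_X$, a slice of $B_X$ is a set $S(x^*,\alpha)=\{x\in B_X\colon x^*(x)>1-\alpha\}$ with $x^*\in X^*$, $\|x^*\|=1$, and $\alpha>0$. A norm-one element $f\in\operatorname{Lip}_0(M)$ is a Daugavet point if, for every slice $S$ of the closed unit ball of $\operatorname{Lip}_0(M)$ and every $\varepsilon>0$, there exists $g\in S$ with $\|f-g\|>2-\varepsilon$. *)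

theory Defs
  imports "HOL-Analysis.Analysis"
begin

class pointed_metric_space = metric_space +
  fixes base_point :: 'a

typedef (overloaded) 'a lip0 =
  "{f :: 'a::pointed_metric_space \<Rightarrow> real. f base_point = 0 \<and> (\<exists>L. L-lipschitz_on UNIV f)}"
  morphisms lip0_apply Lip0
  by (rule exI[of _ "\<lambda>_. 0"]) (auto intro!: exI[of _ 0] simp: lipschitz_on_def)

declare [[coercion lip0_apply]]

setup_lifting type_definition_lip0

lemma lip0_base [simp]: "lip0_apply f base_point = 0"
  using lip0_apply[of f] by simp

lemma lip0_lipschitz: obtains L where "L-lipschitz_on UNIV (lip0_apply f)"
  using lip0_apply[of f] by auto

lemma lip0_eqI: "(\<And>x. lip0_apply f x = lip0_apply g x) \<Longrightarrow> f = g"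
  by (metis ext lip0_apply_inject)

instantiation lip0 :: (pointed_metric_space) real_vector
begin

lift_definition zero_lip0 :: "'a lip0" is "\<lambda>_. 0"
  by (auto intro!: exI[of _ 0] simp: lipschitz_on_def)

lift_definition plus_lip0 :: "'a lip0 \<Rightarrow> 'a lip0 \<Rightarrow> 'a lip0" is "\<lambda>f g x. f x + g x"
  by (auto intro: lipschitz_on_add)

lift_definition uminus_lip0 :: "'a lip0 \<Rightarrow> 'a lip0" is "\<lambda>f x. - f x"
  by (auto intro: lipschitz_on_minus)

lift_definition minus_lip0 :: "'a lip0 \<Rightarrow> 'a lip0 \<Rightarrow> 'a lip0" is "\<lambda>f g x. f x - g x"
  by (auto intro: lipschitz_on_diff)

lift_definition scaleR_lip0 :: "real \<Rightarrow> 'a lip0 \<Rightarrow> 'a lip0" is "\<lambda>c f x. c * f x"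
  by (auto intro: lipschitz_on_cmult_real)

instance
  by standard (transfer; auto simp: algebra_simps)+

end

lemmas lip0_apply_simps [simp] =
  zero_lip0.rep_eq plus_lip0.rep_eq uminus_lip0.rep_eq minus_lip0.rep_eq scaleR_lip0.rep_eq

definition lip0_quotients :: "'a::pointed_metric_space lip0 \<Rightarrow> real set" where
  "lip0_quotients f = {\<bar>f x - f y\<bar> / dist x y | x y. x \<noteq> y}"

lemma lip0_quotients_bdd: "bdd_above (insert 0 (lip0_quotients f))"
proof -
  obtain L where L: "L-lipschitz_on UNIV (lip0_apply f)"
    by (rule lip0_lipschitz)
  have "\<bar>f x - f y\<bar> / dist x y \<le> L" if "x \<noteq> y" for x y
    using lipschitz_onD[OF L, of x y] that by (simp add: dist_real_def divide_simps)
  then show ?thesis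
    unfolding bdd_above_insert by (auto simp: bdd_above_def lip0_quotients_def)
qed

instantiation lip0 :: (pointed_metric_space) real_normed_vector
begin

text \<open>All quotients are nonnegative; inserting \<open>0\<close> only matters when the space is a single
  point, where \<open>Sup {} :: real\<close> is unspecified and the norm has to be \<open>0\<close>.\<close>
definition norm_lip0 :: "'a lip0 \<Rightarrow> real" where
  "norm_lip0 f = Sup (insert 0 (lip0_quotients f))"

definition dist_lip0 :: "'a lip0 \<Rightarrow> 'a lip0 \<Rightarrow> real" where
  "dist_lip0 f g = norm (f - g)"

definition sgn_lip0 :: "'a lip0 \<Rightarrow> 'a lip0" where
  "sgn_lip0 f = f /\<^sub>R norm f"

definition uniformity_lip0 :: "('a lip0 \<times> 'a lip0) filter" where
  "uniformity_lip0 = (INF e\<in>{0 <..}. principal {(f, g). dist f g < e})"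

definition open_lip0 :: "'a lip0 set \<Rightarrow> bool" where
  "open_lip0 U = (\<forall>f\<in>U. \<forall>\<^sub>F (f', g) in uniformity. f' = f \<longrightarrow> g \<in> U)"

lemma lip0_norm_nonneg: "0 \<le> norm (f :: 'a lip0)"
  unfolding norm_lip0_def by (rule cSup_upper[OF _ lip0_quotients_bdd]) simp

lemma lip0_norm_bound: "\<bar>f x - f y\<bar> \<le> norm f * dist x y" for f :: "'a lip0"
proof (cases "x = y")
  case False
  then have "\<bar>f x - f y\<bar> / dist x y \<le> norm f"
    unfolding norm_lip0_def
    by (intro cSup_upper[OF _ lip0_quotients_bdd]) (auto simp: lip0_quotients_def)
  with False show ?thesis by (simp add: divide_simps)
qed simp

lemma lip0_norm_least:
  fixes f :: "'a lip0"
  assumes "0 \<le> C" "\<And>x y. \<bar>f x - f y\<bar> \<le> C * dist x y"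
  shows "norm f \<le> C"
proof -
  have "\<bar>f x - f y\<bar> / dist x y \<le> C" if "x \<noteq> y" for x y
    using assms(2)[of x y] that by (simp add: divide_simps)
  then show ?thesis
    unfolding norm_lip0_def
    by (intro cSup_least) (use assms(1) in \<open>auto simp: lip0_quotients_def\<close>)
qed

instance
proof
  fix f g :: "'a lip0" and c :: real
  show "dist f g = norm (f - g)" by (rule dist_lip0_def)
  show "sgn f = f /\<^sub>R norm f" by (rule sgn_lip0_def)
  show "uniformity = (INF e\<in>{0 <..}. principal {(f, g :: 'a lip0). dist f g < e})"
    by (rule uniformity_lip0_def)
  show "open U = (\<forall>f\<in>U. \<forall>\<^sub>F (f', g) in uniformity. f' = f \<longrightarrow> g \<in> U)" for U :: "'a lip0 set"
    by (rule open_lip0_def)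
  show "norm f = 0 \<longleftrightarrow> f = 0"
  proof
    assume "norm f = 0"
    then have "f x = 0" for x using lip0_norm_bound[of f x base_point] by simp
    then show "f = 0" by (intro lip0_eqI) simp
  next
    assume "f = 0"
    then have "norm f \<le> 0" by (intro lip0_norm_least) auto
    then show "norm f = 0" using lip0_norm_nonneg[of f] by simp
  qed
  show "norm (f + g) \<le> norm f + norm g"
  proof (rule lip0_norm_least)
    fix x y
    show "\<bar>(f + g) x - (f + g) y\<bar> \<le> (norm f + norm g) * dist x y"
      using lip0_norm_bound[of f x y] lip0_norm_bound[of g x y]
      by (simp add: algebra_simps)
  qed (simp add: lip0_norm_nonneg)
  have le: "norm (c *\<^sub>R f) \<le> \<bar>c\<bar> * norm f" for c and f :: "'a lip0"
  proof (rule lip0_norm_least)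
    fix x y
    have "\<bar>(c *\<^sub>R f) x - (c *\<^sub>R f) y\<bar> = \<bar>c\<bar> * \<bar>f x - f y\<bar>"
      by (simp add: abs_mult flip: right_diff_distrib)
    then show "\<bar>(c *\<^sub>R f) x - (c *\<^sub>R f) y\<bar> \<le> \<bar>c\<bar> * norm f * dist x y"
      using mult_left_mono[OF lip0_norm_bound[of f x y], of "\<bar>c\<bar>"] by (simp add: mult.assoc)
  qed (simp add: lip0_norm_nonneg)
  show "norm (c *\<^sub>R f) = \<bar>c\<bar> * norm f"
  proof (cases "c = 0")
    case True
    then show ?thesis using le[of 0 f] lip0_norm_nonneg[of "0 *\<^sub>R f"] by simp
  next
    case False
    then have "\<bar>c\<bar> * norm f \<le> norm (c *\<^sub>R f)"
      using le[of "inverse c" "c *\<^sub>R f"] by (simp add: divide_simps mult.commute)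
    with le[of c f] show ?thesis by simp
  qed
qed

end

lemma norm_lip0_eq_Sup:
  fixes f :: "'a::pointed_metric_space lip0"
  assumes "\<exists>x y :: 'a. x \<noteq> y"
  shows "norm f = Sup {\<bar>f x - f y\<bar> / dist x y | x y. x \<noteq> y}"
proof -
  from assms obtain a b :: 'a where "a \<noteq> b" by blast
  then obtain q where q: "q \<in> lip0_quotients f" "0 \<le> q"
    unfolding lip0_quotients_def by (blast intro: divide_nonneg_nonneg[OF abs_ge_zero zero_le_dist])
  have bdd: "bdd_above (lip0_quotients f)"
    using lip0_quotients_bdd[of f] by simp
  have "0 \<le> Sup (lip0_quotients f)"
    using q cSup_upper[OF q(1) bdd] by simp
  then have "norm f = Sup (lip0_quotients f)"
    unfolding norm_lip0_def using q(1) bdd by (subst cSup_insert) (auto simp: sup_max)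
  then show ?thesis by (simp add: lip0_quotients_def)
qed

instance lip0 :: (pointed_metric_space) banach
proof
  fix F :: "nat \<Rightarrow> 'a lip0"
  assume F: "Cauchy F"
  have pt: "\<bar>(F m x - F n x) - (F m y - F n y)\<bar> \<le> norm (F m - F n) * dist x y" for m n x y
    using lip0_norm_bound[of "F m - F n" x y] by simp
  have ptC: "Cauchy (\<lambda>n. F n x)" for x
  proof (rule CauchyI)
    fix e :: real assume "0 < e"
    let ?d = "dist x base_point + 1"
    have "0 < ?d" by (simp add: add_nonneg_pos)
    with \<open>0 < e\<close> obtain N where N: "\<And>m n. N \<le> m \<Longrightarrow> N \<le> n \<Longrightarrow> norm (F m - F n) < e / ?d"
      using CauchyD[OF F, of "e / ?d"] by auto
    show "\<exists>N. \<forall>m\<ge>N. \<forall>n\<ge>N. norm (F m x - F n x) < e"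
    proof (intro exI allI impI)
      fix m n assume "N \<le> m" "N \<le> n"
      have "norm (F m x - F n x) \<le> norm (F m - F n) * dist x base_point"
        using pt[of m x n base_point] by simp
      also have "\<dots> \<le> norm (F m - F n) * ?d" by (intro mult_left_mono) auto
      also have "\<dots> < e" using N[OF \<open>N \<le> m\<close> \<open>N \<le> n\<close>] \<open>0 < ?d\<close> by (simp add: pos_less_divide_eq)
      finally show "norm (F m x - F n x) < e" .
    qed
  qed
  define g where "g x = lim (\<lambda>n. F n x)" for x
  have g: "(\<lambda>n. F n x) \<longlonglongrightarrow> g x" for x
    using ptC[of x] unfolding g_def by (simp add: Cauchy_convergent_iff convergent_LIMSEQ_iff)
  obtain B where B: "\<And>n. norm (F n) \<le> B"
    using Cauchy_Bseq[OF F] by (auto simp: Bseq_def)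
  have "0 \<le> B" using B[of 0] norm_ge_zero[of "F 0"] by linarith
  have "\<bar>g x - g y\<bar> \<le> B * dist x y" for x y
  proof (rule LIMSEQ_le_const2)
    show "(\<lambda>n. \<bar>F n x - F n y\<bar>) \<longlonglongrightarrow> \<bar>g x - g y\<bar>" by (intro tendsto_intros g)
    show "\<exists>N. \<forall>n\<ge>N. \<bar>F n x - F n y\<bar> \<le> B * dist x y"
      using order_trans[OF lip0_norm_bound mult_right_mono[OF B zero_le_dist]] by blast
  qed
  then have "B-lipschitz_on UNIV g"
    using \<open>0 \<le> B\<close> by (auto simp: lipschitz_on_def dist_real_def)
  moreover have "g base_point = 0" by (simp add: g_def)
  ultimately have app: "lip0_apply (Lip0 g) = g" by (intro Lip0_inverse) auto
  have "F \<longlonglongrightarrow> Lip0 g"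
  proof (rule LIMSEQ_I)
    fix e :: real assume "0 < e"
    then obtain N where N: "\<And>m n. N \<le> m \<Longrightarrow> N \<le> n \<Longrightarrow> norm (F m - F n) < e / 2"
      using CauchyD[OF F, of "e / 2"] by auto
    have "norm (F n - Lip0 g) \<le> e / 2" if "N \<le> n" for n
    proof (rule lip0_norm_least)
      fix x y
      show "\<bar>(F n - Lip0 g) x - (F n - Lip0 g) y\<bar> \<le> e / 2 * dist x y"
      proof (rule LIMSEQ_le_const2)
        show "(\<lambda>m. \<bar>(F n x - F m x) - (F n y - F m y)\<bar>)
          \<longlonglongrightarrow> \<bar>(F n - Lip0 g) x - (F n - Lip0 g) y\<bar>"
          unfolding minus_lip0.rep_eq app by (intro tendsto_intros g)
        show "\<exists>N. \<forall>m\<ge>N. \<bar>(F n x - F m x) - (F n y - F m y)\<bar> \<le> e / 2 * dist x y"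
          using order_trans[OF pt mult_right_mono[OF less_imp_le[OF N[OF that]] zero_le_dist]]
          by blast
      qed
    qed (use \<open>0 < e\<close> in simp)
    then show "\<exists>N. \<forall>n\<ge>N. norm (F n - Lip0 g) < e"
      using \<open>0 < e\<close> by (intro exI[of _ N]) (smt (verit) field_sum_of_halves)
  qed
  then show "convergent F" by (rule convergentI)
qed

text \<open>\<open>molecule_value f x y\<close> is \<open>f(m\<^sub>x\<^sub>,\<^sub>y)\<close>; it is only meaningful for \<open>x \<noteq> y\<close>.\<close>
definition molecule_value :: "'a::pointed_metric_space lip0 \<Rightarrow> 'a \<Rightarrow> 'a \<Rightarrow> real" where
  "molecule_value f x y = (f x - f y) / dist x y"

definition lip0_local :: "'a::pointed_metric_space lip0 \<Rightarrow> bool" where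
  "lip0_local f \<longleftrightarrow> (\<forall>\<epsilon>>0. \<exists>u v. u \<noteq> v \<and> dist u v < \<epsilon> \<and> molecule_value f u v > norm f - \<epsilon>)"

definition slice :: "('x::banach \<Rightarrow>\<^sub>L real) \<Rightarrow> real \<Rightarrow> 'x set" where
  "slice \<phi> \<alpha> = {x \<in> cball 0 1. blinfun_apply \<phi> x > 1 - \<alpha>}"

definition is_slice :: "'x::banach set \<Rightarrow> bool" where
  "is_slice S \<longleftrightarrow> (\<exists>\<phi> :: 'x \<Rightarrow>\<^sub>L real. \<exists>\<alpha>>0. norm \<phi> = 1 \<and> S = slice \<phi> \<alpha>)"

definition Daugavet_point :: "'x::banach \<Rightarrow> bool" where
  "Daugavet_point x \<longleftrightarrow>
    norm x = 1 \<and> (\<forall>S. is_slice S \<longrightarrow> (\<forall>\<epsilon>>0. \<exists>y\<in>S. norm (x - y) > 2 - \<epsilon>))"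

end

theory Submission
  imports Defs
begin

text \<open>
  Suppose that a slice \<open>\<phi> > 1 - \<alpha>\<close> contains no point at distance more than \<open>2 - \<epsilon>\<close> from \<open>f\<close>,
  and fix \<open>h\<close> in it with \<open>\<parallel>h\<parallel> < 1\<close>. If \<open>u\<close>, \<open>v\<close> are very close together and
  \<open>f(m\<^sub>u\<^sub>,\<^sub>v) \<approx> 1\<close>, then the spare slope \<open>1 - \<parallel>h\<parallel>\<close> allows \<open>h\<close> to be altered, up to an additive
  constant, on a small ball around \<open>v\<close> only, to a function \<open>g\<close> of norm at most \<open>1\<close> with \<open>g(m\<^sub>u\<^sub>,\<^sub>v) \<approx> -1\<close>, so
  \<open>\<parallel>f - g\<parallel> > 2 - \<epsilon>\<close>. By assumption \<open>g\<close> lies outside the slice, so \<open>\<phi> (g - h)\<close> is at most a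
  negative constant that does not depend on \<open>g\<close>.

  The point is to find arbitrarily many such perturbations \<open>g - h\<close> whose sum has norm less
  than \<open>3\<close>; this contradicts the boundedness of \<open>\<phi>\<close>. The sum stays bounded if each new
  perturbation lives, up to a constant, on a ball that is tiny compared with a
  concentric ball on which the sum \<open>T\<close> of the previous ones is constant
  (\<open>norm_add_bump_le\<close>). For this to go on, \<open>T\<close> has to be constant on balls of one fixed radius
  around \<open>v\<close> for pairs \<open>(u, v)\<close> that still witness the locality of \<open>f\<close>. Either the witnesses
  away from some pair suffice, and then a perturbation around that pair is constant near all
  of them; or they cluster around a point \<open>p\<close>, and then the perturbation is made constant near
  \<open>p\<close> at a cost that is small compared with the distance of \<open>u\<close> and \<open>v\<close> (\<open>exists_bump\<close>).
\<close>

section \<open>Sets of pairs that witness locality\<close>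

text \<open>The pairs in \<open>W\<close> alone suffice to witness that \<open>f\<close> is local.\<close>
definition local_on :: "'a::pointed_metric_space lip0 \<Rightarrow> ('a \<times> 'a) set \<Rightarrow> bool" where
  "local_on f W \<longleftrightarrow>
    (\<forall>e>0. \<exists>u v. (u, v) \<in> W \<and> u \<noteq> v \<and> dist u v < e \<and> molecule_value f u v > norm f - e)"

lemma lip0_local_iff_local_on: "lip0_local f \<longleftrightarrow> local_on f UNIV"
  by (simp add: lip0_local_def local_on_def)

lemma local_onE:
  assumes "local_on f W" "0 < d" "0 < e"
  obtains u v where "(u, v) \<in> W" "u \<noteq> v" "dist u v < d" "molecule_value f u v > norm f - e"
proof -
  have "0 < min d e" using assms by simp
  then obtain u v where "(u, v) \<in> W" "u \<noteq> v" "dist u v < min d e"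
    "molecule_value f u v > norm f - min d e"
    using assms(1) unfolding local_on_def by blast
  then show thesis by (intro that) auto
qed

lemma local_on_Un:
  assumes "local_on f (A \<union> B)"
  shows "local_on f A \<or> local_on f B"
proof (rule ccontr)
  assume "\<not> ?thesis"
  then have "\<not> local_on f A" "\<not> local_on f B" by auto
  then obtain d e where de: "0 < d" "0 < e"
    and A: "\<And>u v. (u, v) \<in> A \<Longrightarrow> u \<noteq> v \<Longrightarrow> dist u v < d \<Longrightarrow> \<not> molecule_value f u v > norm f - d"
    and B: "\<And>u v. (u, v) \<in> B \<Longrightarrow> u \<noteq> v \<Longrightarrow> dist u v < e \<Longrightarrow> \<not> molecule_value f u v > norm f - e"
    unfolding local_on_def by metis
  from de have "0 < min d e" by simp
  from local_onE[OF assms this this] obtain u v where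
    "(u, v) \<in> A \<union> B" "u \<noteq> v" "dist u v < min d e" "molecule_value f u v > norm f - min d e"
    by blast
  then show False using A[of u v] B[of u v] by auto
qed

lemma molecule_value_le_norm:
  assumes "x \<noteq> y"
  shows "molecule_value f x y \<le> norm f"
  using lip0_norm_bound[of f x y] assms by (simp add: molecule_value_def divide_simps)

section \<open>The perturbations\<close>

text \<open>
  The tent \<open>\<psi> = max 0 (h v - h x + \<eta> r - d(x, v))\<close> with \<open>\<eta> = 1 - \<parallel>h\<parallel>\<close> turns \<open>h\<close> into
  \<open>h + \<psi>\<close>, which is the maximum of \<open>h\<close> and \<open>h v + \<eta> r - d(x, v)\<close>. Applying the map \<open>D\<close>,
  which collapses \<open>[-s, s]\<close> to \<open>0\<close> and moves no number by more than \<open>s\<close>, to \<open>\<psi> - \<psi> p\<close> makes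
  the perturbation constant near \<open>p\<close>. Subtracting a constant restores the value \<open>0\<close> at the base
  point; therefore \<open>g - h\<close> is only constant, not zero, away from \<open>v\<close>.
\<close>
lemma exists_bump:
  fixes h :: "'a::pointed_metric_space lip0"
  assumes h: "norm h < 1" and r: "0 < r" and s: "0 < s"
    and duv: "2 * dist u v \<le> (1 - norm h) * r"
  obtains g :: "'a lip0" and c where "norm g \<le> 1"
    and "g u - g v \<le> - dist u v + 2 * s"
    and "\<And>x. r \<le> dist x v \<Longrightarrow> (g - h) x = c"
    and "\<And>x. \<bar>(g - h) x - c\<bar> \<le> r"
    and "\<And>x. 2 * dist x p \<le> s \<Longrightarrow> (g - h) x = (g - h) p"
proof -
  define \<eta> where "\<eta> = 1 - norm h"
  have \<eta>: "0 < \<eta>" "\<eta> \<le> 1" using h by (auto simp: \<eta>_def)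
  have hb: "\<bar>h x - h y\<bar> \<le> (1 - \<eta>) * dist x y" for x y
    using lip0_norm_bound[of h x y] by (simp add: \<eta>_def)
  have hb1: "\<bar>h x - h y\<bar> \<le> dist x y" for x y
  proof -
    have "(1 - \<eta>) * dist x y \<le> 1 * dist x y" using \<eta> by (intro mult_right_mono) auto
    then show ?thesis using hb[of x y] by simp
  qed
  have \<eta>r: "0 \<le> \<eta> * r" "\<eta> * r \<le> r" using \<eta> r by (auto simp: mult_left_le_one_le)
  define \<psi> where "\<psi> x = max 0 (h v - h x + \<eta> * r - dist x v)" for x
  define D :: "real \<Rightarrow> real" where "D t = max (t - s) (min (t + s) 0)" for t
  define G where "G x = h x + D (\<psi> x - \<psi> p)" for x
  have \<psi>_range: "0 \<le> \<psi> x" "\<psi> x \<le> \<eta> * r" for x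
    using hb1[of v x] \<eta>r by (auto simp: \<psi>_def dist_commute)
  have \<psi>_far: "\<psi> x = 0" if "r \<le> dist x v" for x
  proof -
    have "\<eta> * r \<le> \<eta> * dist x v" using that \<eta> by simp
    then show ?thesis using hb[of v x] by (simp add: \<psi>_def dist_commute algebra_simps)
  qed
  have h\<psi>: "h x + \<psi> x \<le> h y + \<psi> y + dist x y" for x y
    using hb1[of x y] dist_triangle[of y v x] by (auto simp: \<psi>_def dist_commute)
  have D_lip: "\<bar>D a - D b\<bar> \<le> \<bar>a - b\<bar>" for a b
    using s by (auto simp: D_def)
  have D_near: "\<bar>D a - a\<bar> \<le> s" for a
    using s by (auto simp: D_def)
  have D_0: "D a = 0" if "\<bar>a\<bar> \<le> s" for a
    using that by (auto simp: D_def)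
  \<comment> \<open>\<open>G\<close> is a lattice combination of \<open>h\<close> and \<open>h + \<psi>\<close>, up to constants.\<close>
  have G1: "G x \<le> G y + dist x y" for x y
    using h\<psi>[of x y] hb1[of x y] s by (auto simp: G_def D_def max_def min_def)
  have G2: "\<bar>G x - G y\<bar> \<le> dist x y" for x y
    using G1[of x y] G1[of y x] by (simp add: dist_commute abs_le_iff)
  have "1-lipschitz_on UNIV (\<lambda>x. G x - G base_point)"
    using G2 by (auto simp: lipschitz_on_def dist_real_def)
  then have app: "lip0_apply (Lip0 (\<lambda>x. G x - G base_point)) = (\<lambda>x. G x - G base_point)"
    by (intro Lip0_inverse) auto
  define g where "g = Lip0 (\<lambda>x. G x - G base_point)"
  define c where "c = D (- \<psi> p) - G base_point"
  have g: "g x = G x - G base_point" for x by (simp add: g_def app)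
  have gh: "(g - h) x = D (\<psi> x - \<psi> p) - G base_point" for x by (simp add: g G_def)
  show thesis
  proof (rule that)
    show "norm g \<le> 1" using G2 by (intro lip0_norm_least) (auto simp: g)
    have "\<psi> v = \<eta> * r" using \<eta>r by (simp add: \<psi>_def)
    moreover have "\<psi> u = h v - h u + \<eta> * r - dist u v"
      using duv hb1[of u v] by (simp add: \<psi>_def \<eta>_def)
    ultimately show "g u - g v \<le> - dist u v + 2 * s"
      using D_near[of "\<psi> u - \<psi> p"] D_near[of "\<psi> v - \<psi> p"] by (simp add: g G_def)
    show "(g - h) x = c" if "r \<le> dist x v" for x
      unfolding gh c_def \<psi>_far[OF that] by simp
    show "\<bar>(g - h) x - c\<bar> \<le> r" for x
      using D_lip[of "\<psi> x - \<psi> p" "- \<psi> p"] \<psi>_range[of x] \<eta>r unfolding gh c_def by simp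
    show "(g - h) x = (g - h) p" if "2 * dist x p \<le> s" for x
    proof -
      have "\<bar>\<psi> x - \<psi> p\<bar> \<le> s"
        using h\<psi>[of x p] h\<psi>[of p x] hb1[of x p] that by (auto simp: dist_commute)
      then show ?thesis using s by (simp only: gh) (simp add: D_0)
    qed
  qed
qed

text \<open>
  For two points in the ball of radius \<open>R\<close> only \<open>\<psi>\<close> varies. For a point at distance less than
  \<open>r\<close> from \<open>v\<close> and one outside the ball, the distance is at least \<open>R / 2\<close>, while \<open>\<psi>\<close>
  varies by at most \<open>r\<close>.
\<close>
lemma norm_add_bump_le:
  fixes T \<psi> :: "'a::pointed_metric_space lip0"
  assumes T: "\<And>x. dist x v < R \<Longrightarrow> T x = T v"
    and \<psi>: "\<And>x. r \<le> dist x v \<Longrightarrow> \<psi> x = c" "\<And>x. \<bar>\<psi> x - c\<bar> \<le> r"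
    and r: "0 \<le> r" "2 * r \<le> R" "0 < R"
  shows "norm (T + \<psi>) \<le> max (norm \<psi>) (norm T + 2 * r / R)"
proof (rule lip0_norm_least)
  define K where "K = max (norm \<psi>) (norm T + 2 * r / R)"
  have K: "norm \<psi> * dist x y \<le> K * dist x y"
    "norm T * dist x y + 2 * r / R * dist x y \<le> K * dist x y" for x y
  proof -
    show "norm \<psi> * dist x y \<le> K * dist x y"
      unfolding K_def by (intro mult_right_mono) auto
    show "norm T * dist x y + 2 * r / R * dist x y \<le> K * dist x y"
      unfolding K_def distrib_right[symmetric] by (intro mult_right_mono) auto
  qed
  have extra: "0 \<le> 2 * r / R * dist x y" for x y using r by simp
  have near: "\<bar>(T + \<psi>) x - (T + \<psi>) y\<bar> \<le> K * dist x y" if x: "dist x v < r" for x y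
  proof (cases "dist y v < R")
    case True
    then have "T x = T y" using T[of x] T[of y] x r by simp
    then show ?thesis using lip0_norm_bound[of \<psi> x y] K(1)[of x y] by simp
  next
    case False
    then have "R \<le> 2 * dist x y"
      using x r dist_triangle[of y v x] by (simp add: dist_commute)
    then have "r * R \<le> r * (2 * dist x y)" using r by (intro mult_left_mono) auto
    then have "r \<le> 2 * r / R * dist x y" using r by (simp add: field_simps)
    moreover have "\<psi> y = c" using False r by (intro \<psi>(1)) auto
    ultimately show ?thesis
      using lip0_norm_bound[of T x y] K(2)[of x y] \<psi>(2)[of x] by simp
  qed
  fix x y
  show "\<bar>(T + \<psi>) x - (T + \<psi>) y\<bar> \<le> max (norm \<psi>) (norm T + 2 * r / R) * dist x y"
  proof (cases "dist x v < r \<or> dist y v < r")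
    case True
    then show ?thesis using near[of x y] near[of y x]
      by (auto simp: K_def dist_commute abs_minus_commute)
  next
    case False
    then have "\<psi> x = \<psi> y" using \<psi>(1)[of x] \<psi>(1)[of y] by simp
    then show ?thesis using lip0_norm_bound[of T x y] K(2)[of x y] extra[of x y]
      by (simp add: K_def)
  qed
qed (use norm_ge_zero[of \<psi>] in linarith)

section \<open>Accumulating perturbations\<close>

text \<open>
  One step of the construction: \<open>T\<close>, the sum of the previous perturbations, is constant near all
  pairs in \<open>W\<close>, and the step preserves this after shrinking \<open>W\<close> and the radius.
\<close>
lemma exists_next_perturbation:
  fixes f h T :: "'a::pointed_metric_space lip0"
  assumes f: "norm f = 1" and h: "norm h < 1" and e: "0 < e"
    and W: "local_on f W" and R: "0 < R" and T3: "norm T < 3"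
    and T: "\<And>u v x. (u, v) \<in> W \<Longrightarrow> dist x v < R \<Longrightarrow> T x = T v"
  obtains g :: "'a lip0" and W' R' where "norm g \<le> 1" "norm (f - g) > 2 - e"
    and "local_on f W'" "0 < R'" "norm (T + (g - h)) < 3"
    and "\<And>u v x. (u, v) \<in> W' \<Longrightarrow> dist x v < R' \<Longrightarrow> (T + (g - h)) x = (T + (g - h)) v"
proof -
  have \<eta>: "0 < 1 - norm h" using h by simp
  \<comment> \<open>A perturbation of radius at most \<open>r\<close> uses up at most half of the gap \<open>3 - \<parallel>T\<parallel>\<close>.\<close>
  define r where "r = min (R / 2) ((3 - norm T) * R / 4)"
  have r: "0 < r" using R T3 by (simp add: r_def)
  have sum_lt: "norm (T + (g - h)) < 3"
    if uv: "(u, v) \<in> W" and \<rho>: "0 < \<rho>" "\<rho> \<le> r" and g: "norm g \<le> 1"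
      "\<And>x. \<rho> \<le> dist x v \<Longrightarrow> (g - h) x = c" "\<And>x. \<bar>(g - h) x - c\<bar> \<le> \<rho>"
    for g :: "'a lip0" and u v c \<rho>
  proof -
    have "norm (T + (g - h)) \<le> max (norm (g - h)) (norm T + 2 * \<rho> / R)"
      using T[OF uv] g(2,3) \<rho> R by (intro norm_add_bump_le) (auto simp: r_def)
    moreover have "norm (g - h) < 3"
      using norm_triangle_ineq4[of g h] g(1) h by simp
    moreover have "2 * \<rho> / R \<le> (3 - norm T) / 2"
      using \<rho> R by (simp add: r_def field_simps)
    ultimately show ?thesis using T3 by simp
  qed
  have far: "norm (f - g) > 2 - e"
    if uv: "u \<noteq> v" "molecule_value f u v > norm f - e / 2"
      and g: "g u - g v \<le> - dist u v + 2 * (e * dist u v / 4)" for g :: "'a lip0" and u v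
  proof -
    have "molecule_value (f - g) u v = molecule_value f u v - (g u - g v) / dist u v"
      by (simp add: molecule_value_def diff_divide_distrib)
    moreover have "(g u - g v) / dist u v \<le> -1 + e / 2"
    proof (subst pos_divide_le_eq)
      show "g u - g v \<le> (-1 + e / 2) * dist u v" using g by (simp add: algebra_simps)
    qed (use uv(1) in simp)
    ultimately show ?thesis
      using molecule_value_le_norm[OF uv(1), of "f - g"] uv(2) f by simp
  qed
  have "0 < (1 - norm h) * r / 2" "0 < e / 2" using \<eta> r e by auto
  from local_onE[OF W this] obtain u v where uv: "(u, v) \<in> W" "u \<noteq> v"
    "dist u v < (1 - norm h) * r / 2" "molecule_value f u v > norm f - e / 2" .
  define s where "s = e * dist u v / 4"
  have s: "0 < s" using e uv by (simp add: s_def)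
  \<comment> \<open>If the pairs in \<open>W\<close> cluster around \<open>p\<close> at scale \<open>\<rho>\<close>, then the perturbation around \<open>v\<close> can be
    made constant near all of them; otherwise \<open>(q, p)\<close> is itself a good place for one.\<close>
  define \<rho> where "\<rho> = min r (s / 8)"
  have \<rho>: "0 < \<rho>" "\<rho> \<le> r" "8 * \<rho> \<le> s" using r s by (auto simp: \<rho>_def)
  have "0 < (1 - norm h) * \<rho> / 2" "0 < e / 2" using \<eta> \<rho> e by auto
  from local_onE[OF W this] obtain q p where qp: "(q, p) \<in> W" "q \<noteq> p"
    "dist q p < (1 - norm h) * \<rho> / 2" "molecule_value f q p > norm f - e / 2" .
  define A where "A = {(a, b). (a, b) \<in> W \<and> 2 * \<rho> \<le> dist b p}"
  define B where "B = {(a, b). (a, b) \<in> W \<and> dist b p < 2 * \<rho>}"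
  have "W = A \<union> B" by (auto simp: A_def B_def)
  then consider "local_on f A" | "local_on f B" using local_on_Un W by blast
  then show thesis
  proof cases
    case 1
    \<comment> \<open>Here the flattening around \<open>p\<close> plays no role: the pairs in \<open>A\<close> lie outside the tent.\<close>
    have "0 < e * dist q p / 4" "2 * dist q p \<le> (1 - norm h) * \<rho>" using e qp by auto
    from exists_bump[OF h \<rho>(1) this, of p] obtain g :: "'a lip0" and c where g: "norm g \<le> 1"
      "g q - g p \<le> - dist q p + 2 * (e * dist q p / 4)"
      "\<And>x. \<rho> \<le> dist x p \<Longrightarrow> (g - h) x = c" "\<And>x. \<bar>(g - h) x - c\<bar> \<le> \<rho>" by metis
    show thesis
    proof (rule that[of g A "min \<rho> R"])
      show "norm (f - g) > 2 - e" using qp g by (intro far) auto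
      show "norm (T + (g - h)) < 3" using sum_lt[OF qp(1) \<rho>(1,2) g(1,3,4)] .
      fix a b x assume ab: "(a, b) \<in> A" and x: "dist x b < min \<rho> R"
      have "\<rho> \<le> dist x p" "\<rho> \<le> dist b p"
        using ab x \<rho> dist_triangle[of b p x] by (auto simp: A_def dist_commute)
      then have "(g - h) x = (g - h) b" using g(3) by simp
      moreover have "T x = T b" using ab x by (intro T) (auto simp: A_def)
      ultimately show "(T + (g - h)) x = (T + (g - h)) b" by simp
    qed (use g \<rho> R 1 in auto)
  next
    case 2
    have "2 * dist u v \<le> (1 - norm h) * r" using uv by auto
    from exists_bump[OF h r s this, of p] obtain g :: "'a lip0" and c where g: "norm g \<le> 1"
      "g u - g v \<le> - dist u v + 2 * s"
      "\<And>x. r \<le> dist x v \<Longrightarrow> (g - h) x = c" "\<And>x. \<bar>(g - h) x - c\<bar> \<le> r"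
      "\<And>x. 2 * dist x p \<le> s \<Longrightarrow> (g - h) x = (g - h) p" by metis
    show thesis
    proof (rule that[of g B "min \<rho> R"])
      show "norm (f - g) > 2 - e" using uv g(2) by (intro far) (auto simp: s_def)
      show "norm (T + (g - h)) < 3" using sum_lt[OF uv(1) r order_refl g(1,3,4)] .
      fix a b x assume ab: "(a, b) \<in> B" and x: "dist x b < min \<rho> R"
      have "2 * dist x p \<le> s" "2 * dist b p \<le> s"
        using ab x \<rho> dist_triangle[of x p b] by (auto simp: B_def)
      then have "(g - h) x = (g - h) b" using g(5) by metis
      moreover have "T x = T b" using ab x by (intro T) (auto simp: B_def)
      ultimately show "(T + (g - h)) x = (T + (g - h)) b" by simp
    qed (use g \<rho> R 2 in auto)
  qed
qed

lemma exists_in_slice_norm_less_1: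
  fixes \<phi> :: "'x::real_normed_vector \<Rightarrow>\<^sub>L real"
  assumes "norm \<phi> = 1" "0 < \<alpha>"
  obtains h where "norm h < 1" "blinfun_apply \<phi> h > 1 - \<alpha>"
proof -
  define b where "b = max 0 (1 - \<alpha>)"
  have b: "0 \<le> b" "b < 1" "1 - \<alpha> \<le> b" using assms(2) by (auto simp: b_def)
  have "\<exists>x. \<bar>\<phi> x\<bar> > b * norm x"
  proof (rule ccontr)
    assume "\<not> ?thesis"
    then have "norm \<phi> \<le> b" using b
      by (intro norm_blinfun_bound) (auto simp: not_less)
    then show False using assms(1) b by simp
  qed
  then obtain x where x: "\<bar>\<phi> x\<bar> > b * norm x" by blast
  define y where "y = (sgn (\<phi> x) / norm x) *\<^sub>R x"
  have "x \<noteq> 0" using x by auto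
  have "\<phi> x \<noteq> 0" using x mult_nonneg_nonneg[OF b(1) norm_ge_zero[of x]] by auto
  then have ny: "norm y = 1" using \<open>x \<noteq> 0\<close> by (simp add: y_def abs_sgn_eq)
  have "\<phi> y = \<bar>\<phi> x\<bar> / norm x"
    by (simp add: y_def blinfun.scaleR_right abs_sgn mult.commute)
  then have \<phi>y: "\<phi> y > b" using x \<open>x \<noteq> 0\<close> by (simp add: pos_less_divide_eq)
  define t where "t = (b / \<phi> y + 1) / 2"
  have "0 \<le> b / \<phi> y" "b / \<phi> y < 1" using b \<phi>y by auto
  then have t: "0 < t" "t < 1" by (auto simp: t_def)
  have "t * \<phi> y = (b + \<phi> y) / 2" using b \<phi>y by (simp add: t_def field_simps)
  then have "\<phi> (t *\<^sub>R y) > 1 - \<alpha>" using b \<phi>y by (simp add: blinfun.scaleR_right)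
  moreover have "norm (t *\<^sub>R y) < 1" using t ny by simp
  ultimately show thesis using that by blast
qed

theorem theorem1p4:
  fixes f :: "'a::pointed_metric_space lip0"
  assumes "norm f = 1" and "lip0_local f"
  shows "Daugavet_point f"
proof -
  have "\<exists>y\<in>slice \<phi> \<alpha>. norm (f - y) > 2 - e"
    if \<phi>: "norm \<phi> = 1" and \<alpha>: "0 < \<alpha>" and e: "0 < e"
    for \<phi> :: "'a lip0 \<Rightarrow>\<^sub>L real" and \<alpha> e
  proof (rule ccontr)
    assume "\<not> ?thesis"
    then have out: "\<phi> g \<le> 1 - \<alpha>" if "norm g \<le> 1" "norm (f - g) > 2 - e" for g
      using that by (auto simp: slice_def not_less)
    obtain h where h: "norm h < 1" "\<phi> h > 1 - \<alpha>"
      using exists_in_slice_norm_less_1[OF \<phi> \<alpha>] .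
    define c where "c = \<phi> h - (1 - \<alpha>)"
    have "0 < c" using h by (simp add: c_def)
    have sums: "\<exists>(T :: 'a lip0) W R. local_on f W \<and> 0 < R \<and> norm T < 3 \<and> \<phi> T \<le> - (real n * c) \<and>
        (\<forall>u v x. (u, v) \<in> W \<longrightarrow> dist x v < R \<longrightarrow> T x = T v)" for n
    proof (induction n)
      case 0
      show ?case
        using assms(2) by (intro exI[of _ 0] exI[of _ UNIV] exI[of _ 1])
          (auto simp: lip0_local_iff_local_on)
    next
      case (Suc n)
      then obtain T :: "'a lip0" and W R where IH: "local_on f W" "0 < R" "norm T < 3" "\<phi> T \<le> - (real n * c)"
        "\<And>u v x. (u, v) \<in> W \<Longrightarrow> dist x v < R \<Longrightarrow> T x = T v" by blast
      obtain g :: "'a lip0" and W' R' where g: "norm g \<le> 1" "norm (f - g) > 2 - e"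
        "local_on f W'" "0 < R'" "norm (T + (g - h)) < 3"
        "\<And>u v x. (u, v) \<in> W' \<Longrightarrow> dist x v < R' \<Longrightarrow> (T + (g - h)) x = (T + (g - h)) v"
        using exists_next_perturbation[OF assms(1) h(1) e IH(1-3)] IH(5) by metis
      have "\<phi> (T + (g - h)) \<le> - (real (Suc n) * c)"
        using out[OF g(1,2)] IH(4)
        by (simp add: blinfun.add_right blinfun.diff_right c_def algebra_simps)
      then show ?case using g(3-6) by blast
    qed
    obtain n :: nat where n: "3 < real n * c"
      using reals_Archimedean3[OF \<open>0 < c\<close>] by blast
    obtain T where T: "norm T < 3" "\<phi> T \<le> - (real n * c)"
      using sums[of n] by blast
    have "\<bar>\<phi> T\<bar> \<le> norm T" using norm_blinfun[of \<phi> T] \<phi> by simp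
    then show False using T n by simp
  qed
  then show ?thesis
    using assms(1) unfolding Daugavet_point_def is_slice_def by blast
qed

end
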